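(* Let $\alpha_1,\alpha_2,\alpha_3,\beta_1,\beta_2,\lambda_1$ be real parameters of a generalized quadratic number system $\mathfrak{Q}$ with associated coefficients $A,B,C,D,E,F$ (see context), and assume $\mathbf{M}_{\mathfrak{Q}}$ is non-degenerate. Let $\mathbf{v}=(x,y,z)\in\mathbb{R}^3$ be a quadratic vector and let $$\mathfrak{S}=\begin{bmatrix} -\alpha_1y-\beta_1z & \alpha_1x-\lambda_1z & \beta_1x+\lambda_1y \\ -\beta_2z-\alpha_2y & \alpha_2x+\beta_1z & \beta_2x-\beta_1y \\ \alpha_2z-\alpha_3y & \alpha_3x-\alpha_1z & \alpha_1y-\alpha_2x \end{bmatrix}.$$ Then: (a) if $\mathbf{v}$ is a unit ellipsoid vector or a unit timelike vector, then for $\theta\in[0,2\pi)$, $\mathfrak{R}_{\mathbf{v}}^{\theta}:=e^{\theta\mathfrak{S}}=I_3+(\sin\theta)\mathfrak{S}+(1-\cos\theta)\mathfrak{S}^2$; (b) if $\mathbf{v}$ is a unit spacelike vector, then for $\theta\in\mathbb{R}$, $\mathfrak{R}_{\mathbf{v}}^{\theta}:=e^{\theta\mathfrak{S}}=I_3+(\sinh\theta)\mathfrak{S}-(1-\cosh\theta)\mathfrak{S}^2$; (c) if $\mathbf{v}$ is a lightlike vector, then for $\theta\in\mathbb{R}$, $\mathfrak{R}_{\mathbf{v}}^{\theta}:=e^{-\theta\mathfrak{S}}=I_3-\theta\mathfrak{S}+\dfrac{\theta^2\mathfrak{S}^2}{2!}$; and in each case $\mathfrak{R}_{\mathbf{v}}^{\theta}$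 is a rotation with rotation axis $\mathbf{v}$. Moreover, with $$\sigma_{11}=By^2+Cz^2+Dxy+Exz+2Fyz,\quad \sigma_{12}=Dx^2+Bxy+Fxz,\quad \sigma_{13}=Ex^2+Fxy+Cxz,$$ $$\sigma_{21}=Dy^2+Eyz+Axy,\quad \sigma_{22}=Ax^2+Cz^2+Dxy+2Exz+Fyz,\quad \sigma_{23}=Fy^2+Cyz+Exy,$$ $$\sigma_{31}=Ez^2+Dyz+Axz,\quad \sigma_{32}=Fz^2+Dxz+Byz,\quad \sigma_{33}=Ax^2+By^2+2Dxy+Exz+Fyz,$$ these matrices are, respectively, in case (a): $$\begin{bmatrix} (1-\cos\theta)\sigma_{11}-(y\alpha_1+z\beta_1)\sin\theta+1 & (\cos\theta-1)\sigma_{12}+(x\alpha_1-z\lambda_1)\sin\theta & (\cos\theta-1)\sigma_{13}+(x\beta_1+y\lambda_1)\sin\theta \\ (\cos\theta-1)\sigma_{21}-(y\alpha_2+z\beta_2)\sin\theta & (1-\cos\theta)\sigma_{22}+(x\alpha_2+z\beta_1)\sin\theta+1 & (\cos\theta-1)\sigma_{23}+(x\beta_2-y\beta_1)\sin\theta \\ (\cos\theta-1)\sigma_{31}+(z\alpha_2-y\alpha_3)\sin\theta & (\cos\theta-1)\sigma_{32}+(x\alpha_3-z\alpha_1)\sin\theta & (1-\cos\theta)\sigma_{33}+(y\alpha_1-x\alpha_2)\sin\theta+1 \end{bmatrix},$$ in case (b): $$\begin{bmatrix} (\cosh\theta-1)\sigma_{11}-(y\alpha_1+z\beta_1)\sinh\theta+1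 & (1-\cosh\theta)\sigma_{12}+(x\alpha_1-z\lambda_1)\sinh\theta & (1-\cosh\theta)\sigma_{13}+(x\beta_1+y\lambda_1)\sinh\theta \\ (1-\cosh\theta)\sigma_{21}-(y\alpha_2+z\beta_2)\sinh\theta & (\cosh\theta-1)\sigma_{22}+(x\alpha_2+z\beta_1)\sinh\theta+1 & (1-\cosh\theta)\sigma_{23}+(x\beta_2-y\beta_1)\sinh\theta \\ (1-\cosh\theta)\sigma_{31}+(z\alpha_2-y\alpha_3)\sinh\theta & (1-\cosh\theta)\sigma_{32}+(x\alpha_3-z\alpha_1)\sinh\theta & (\cosh\theta-1)\sigma_{33}+(y\alpha_1-x\alpha_2)\sinh\theta+1 \end{bmatrix},$$ in case (c): $$\begin{bmatrix} \tfrac12\theta^2\sigma_{11}+(y\alpha_1+z\beta_1)\theta+1 & -\tfrac12\theta^2\sigma_{12}+(z\lambda_1-x\alpha_1)\theta & -\tfrac12\theta^2\sigma_{13}-(y\lambda_1+x\beta_1)\theta \\ -\tfrac12\theta^2\sigma_{21}+(y\alpha_2+z\beta_2)\theta & \tfrac12\theta^2\sigma_{22}-(x\alpha_2+z\beta_1)\theta+1 & -\tfrac12\theta^2\sigma_{23}+(y\beta_1-x\beta_2)\theta \\ -\tfrac12\theta^2\sigma_{31}+(y\alpha_3-z\alpha_2)\theta & -\tfrac12\theta^2\sigma_{32}+(z\alpha_1-x\alpha_3)\theta & \tfrac12\theta^2\sigma_{33}+(x\alpha_2-y\alpha_1)\theta+1 \end{bmatrix}.$$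
   Context: Given real numbers $\alpha_1,\alpha_2,\alpha_3,\beta_1,\beta_2,\lambda_1$ (the parameters of a generalized quadratic number system $\mathfrak{Q}$), put $$A=\alpha_2^2+\alpha_3\beta_2,\quad B=\alpha_1^2-\lambda_1\alpha_3,\quad C=\beta_1^2+\lambda_1\beta_2,$$ $$D=-(\alpha_1\alpha_2+\alpha_3\beta_1),\quad E=\alpha_2\beta_1-\beta_2\alpha_1,\quad F=\alpha_1\beta_1+\lambda_1\alpha_2,$$ $$\mathbf{M}_{\mathfrak{Q}}=\begin{bmatrix} A & D & E \\ D & B & F \\ E & F & C \end{bmatrix}.$$ The system is of ellipsoid type if $-\mathbf{M}_{\mathfrak{Q}}$ is positive definite (put $\Delta=-1$; vectors of $\mathbb{R}^3$ are then called ellipsoid vectors), and of indefinite type if $\mathbf{M}_{\mathfrak{Q}}$ is indefinite (and non-degenerate) (put $\Delta=1$). Put $\mathfrak{M}_{\mathfrak{Q}}=\Delta\mathbf{M}_{\mathfrak{Q}}$, $\langle\mathbf{u},\mathbf{w}\rangle_{\mathfrak{Q}}=\mathbf{u}^T\mathfrak{M}_{\mathfrak{Q}}\mathbf{w}$ for $\mathbf{u},\mathbf{w}\in\mathbb{R}^3$, and $\|\mathbf{u}\|_{\mathfrak{Q}}=\sqrt{|\langle\mathbf{u},\mathbf{u}\rangle_{\mathfrak{Q}}|}$; $\mathbf{u}$ is unit if $\|\mathbf{u}\|_{\mathfrak{Q}}=1$. In the indefinite case, with $\mathfrak V(\mathbf{v})=Ax^2+By^2+Cz^2+2Dxy+2Exz+2Fyz$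 for $\mathbf{v}=(x,y,z)$, a nonzero vector $\mathbf{v}$ is timelike if $\mathfrak V(\mathbf{v})<0$, lightlike if $\mathfrak V(\mathbf{v})=0$, and spacelike if $\mathfrak V(\mathbf{v})>0$. Thus $\mathfrak V(\mathbf{v})=-1$ for a unit ellipsoid or unit timelike vector and $\mathfrak V(\mathbf{v})=1$ for a unit spacelike vector. A rotation (on the quadric surfaces of $\mathfrak{Q}$) is a real $3\times3$ matrix $R$ with $R^T\mathfrak{M}_{\mathfrak{Q}}R=\mathfrak{M}_{\mathfrak{Q}}$ and $\det R=1$; $\mathbf{v}$ is its rotation axis if $R\mathbf{v}=\mathbf{v}$. $I_3$ is the $3\times 3$ identity matrix and $e^{X}$ is the matrix exponential. *)

theory Defs
  imports "HOL-Analysis.Analysis"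
begin

text \<open>
  On \<open>real^'n^'n\<close> the class operations \<open>*\<close>, \<open>1\<close>, \<open>^\<close> act
  componentwise, so \<open>exp\<close> is not the matrix exponential; matrix powers are built from
  \<open>**\<close> and \<open>mat 1\<close>.
\<close>

primrec matrix_pow :: "real^'n^'n \<Rightarrow> nat \<Rightarrow> real^'n^'n" where
  "matrix_pow X 0 = mat 1"
| "matrix_pow X (Suc n) = X ** matrix_pow X n"

definition matrix_exp :: "real^'n^'n \<Rightarrow> real^'n^'n" where
  "matrix_exp X = (\<Sum>n. (1 / fact n) *\<^sub>R matrix_pow X n)"

lemma matrix_pow_entry_bound:
  fixes X :: "real^'n^'n"
  shows "\<bar>matrix_pow X n $ i $ j\<bar> \<le> (\<Sum>i\<in>UNIV. \<Sum>k\<in>UNIV. \<bar>X $ i $ k\<bar>) ^ n"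
proof (induction n arbitrary: i j)
  case 0
  show ?case by (simp add: mat_def)
next
  case (Suc n)
  define c where "c = (\<Sum>i\<in>UNIV. \<Sum>k\<in>UNIV. \<bar>X $ i $ k\<bar>)"
  have c0: "0 \<le> c" unfolding c_def by (intro sum_nonneg) auto
  have row: "(\<Sum>k\<in>UNIV. \<bar>X $ i $ k\<bar>) \<le> c"
    unfolding c_def
    by (rule member_le_sum[where f = "\<lambda>i. \<Sum>k\<in>UNIV. \<bar>X $ i $ k\<bar>"])
      (auto intro: sum_nonneg)
  have "\<bar>matrix_pow X (Suc n) $ i $ j\<bar> = \<bar>\<Sum>k\<in>UNIV. X $ i $ k * matrix_pow X n $ k $ j\<bar>"
    by (simp add: matrix_matrix_mult_def)
  also have "\<dots> \<le> (\<Sum>k\<in>UNIV. \<bar>X $ i $ k\<bar> * c ^ n)"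
    by (rule order_trans[OF sum_abs], rule sum_mono)
      (simp add: abs_mult mult_left_mono Suc.IH[folded c_def])
  also have "\<dots> = (\<Sum>k\<in>UNIV. \<bar>X $ i $ k\<bar>) * c ^ n"
    by (simp add: sum_distrib_right)
  also have "\<dots> \<le> c * c ^ n"
    by (rule mult_right_mono[OF row]) (simp add: c0)
  finally show ?case by (simp add: c_def)
qed

lemma summable_matrix_exp:
  fixes X :: "real^'n^'n"
  shows "summable (\<lambda>n. (1 / fact n) *\<^sub>R matrix_pow X n)"
proof -
  define c where "c = (\<Sum>i\<in>UNIV. \<Sum>k\<in>UNIV. \<bar>X $ i $ k\<bar>)"
  define N where "N = real CARD('n)"
  have "norm ((1 / fact n) *\<^sub>R matrix_pow X n) \<le> N * N * (inverse (fact n) * c ^ n)" for n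
  proof -
    have "norm (matrix_pow X n) \<le> (\<Sum>i\<in>UNIV. norm (matrix_pow X n $ i))"
      unfolding norm_vec_def by (rule L2_set_le_sum) simp
    also have "\<dots> \<le> (\<Sum>i\<in>UNIV. \<Sum>j\<in>UNIV. \<bar>matrix_pow X n $ i $ j\<bar>)"
      by (intro sum_mono norm_le_l1_cart)
    also have "\<dots> \<le> (\<Sum>i\<in>(UNIV::'n set). \<Sum>j\<in>(UNIV::'n set). c ^ n)"
      by (intro sum_mono) (simp add: c_def matrix_pow_entry_bound)
    finally have "norm (matrix_pow X n) \<le> N * N * c ^ n"
      by (simp add: N_def)
    then show ?thesis by (simp add: field_simps)
  qed
  moreover have "summable (\<lambda>n. N * N * (inverse (fact n) * c ^ n))"
    by (intro summable_mult summable_exp)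
  ultimately show ?thesis by (rule summable_comparison_test'[where N = 0, rotated])
qed

definition positive_definite :: "real^'n^'n \<Rightarrow> bool" where
  "positive_definite M \<longleftrightarrow> (\<forall>u. u \<noteq> 0 \<longrightarrow> u \<bullet> (M *v u) > 0)"

definition indefinite :: "real^'n^'n \<Rightarrow> bool" where
  "indefinite M \<longleftrightarrow> (\<exists>u. u \<bullet> (M *v u) > 0) \<and> (\<exists>u. u \<bullet> (M *v u) < 0)"

record gqns =
  al1 :: real
  al2 :: real
  al3 :: real
  be1 :: real
  be2 :: real
  la1 :: real

definition coeff_A :: "gqns \<Rightarrow> real" where
  "coeff_A Q = (al2 Q)\<^sup>2 + al3 Q * be2 Q"

definition coeff_B :: "gqns \<Rightarrow> real" where
  "coeff_B Q = (al1 Q)\<^sup>2 - la1 Q * al3 Q"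

definition coeff_C :: "gqns \<Rightarrow> real" where
  "coeff_C Q = (be1 Q)\<^sup>2 + la1 Q * be2 Q"

definition coeff_D :: "gqns \<Rightarrow> real" where
  "coeff_D Q = - (al1 Q * al2 Q + al3 Q * be1 Q)"

definition coeff_E :: "gqns \<Rightarrow> real" where
  "coeff_E Q = al2 Q * be1 Q - be2 Q * al1 Q"

definition coeff_F :: "gqns \<Rightarrow> real" where
  "coeff_F Q = al1 Q * be1 Q + la1 Q * al2 Q"

definition M_mat :: "gqns \<Rightarrow> real^3^3" where
  "M_mat Q = vector
    [vector [coeff_A Q, coeff_D Q, coeff_E Q],
     vector [coeff_D Q, coeff_B Q, coeff_F Q],
     vector [coeff_E Q, coeff_F Q, coeff_C Q]]"

definition ellipsoid_type :: "gqns \<Rightarrow> bool" where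
  "ellipsoid_type Q \<longleftrightarrow> positive_definite (- M_mat Q)"

definition indefinite_type :: "gqns \<Rightarrow> bool" where
  "indefinite_type Q \<longleftrightarrow> indefinite (M_mat Q) \<and> invertible (M_mat Q)"

text \<open>
  Only meaningful for the two types above; the value \<open>1\<close> for systems of neither type is
  never used, since the vector classes below all presuppose a type.
\<close>

definition Delta :: "gqns \<Rightarrow> real" where
  "Delta Q = (if ellipsoid_type Q then -1 else 1)"

definition metric_mat :: "gqns \<Rightarrow> real^3^3" where
  "metric_mat Q = Delta Q *\<^sub>R M_mat Q"

definition gq_inner :: "gqns \<Rightarrow> real^3 \<Rightarrow> real^3 \<Rightarrow> real" where
  "gq_inner Q u w = u \<bullet> (metric_mat Q *v w)"

definition gq_norm :: "gqns \<Rightarrow> real^3 \<Rightarrow> real" where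
  "gq_norm Q u = sqrt \<bar>gq_inner Q u u\<bar>"

definition gq_unit :: "gqns \<Rightarrow> real^3 \<Rightarrow> bool" where
  "gq_unit Q u \<longleftrightarrow> gq_norm Q u = 1"

definition V_form :: "gqns \<Rightarrow> real^3 \<Rightarrow> real" where
  "V_form Q v =
    coeff_A Q * (v $ 1)\<^sup>2 + coeff_B Q * (v $ 2)\<^sup>2 + coeff_C Q * (v $ 3)\<^sup>2
    + 2 * coeff_D Q * v $ 1 * v $ 2 + 2 * coeff_E Q * v $ 1 * v $ 3
    + 2 * coeff_F Q * v $ 2 * v $ 3"

text \<open>Every vector of an ellipsoid-type system is an ellipsoid vector, including \<open>0\<close>.\<close>

definition ellipsoid_vector :: "gqns \<Rightarrow> real^3 \<Rightarrow> bool" where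
  "ellipsoid_vector Q v \<longleftrightarrow> ellipsoid_type Q"

definition timelike :: "gqns \<Rightarrow> real^3 \<Rightarrow> bool" where
  "timelike Q v \<longleftrightarrow> indefinite_type Q \<and> v \<noteq> 0 \<and> V_form Q v < 0"

definition lightlike :: "gqns \<Rightarrow> real^3 \<Rightarrow> bool" where
  "lightlike Q v \<longleftrightarrow> indefinite_type Q \<and> v \<noteq> 0 \<and> V_form Q v = 0"

definition spacelike :: "gqns \<Rightarrow> real^3 \<Rightarrow> bool" where
  "spacelike Q v \<longleftrightarrow> indefinite_type Q \<and> v \<noteq> 0 \<and> V_form Q v > 0"

definition is_rotation :: "gqns \<Rightarrow> real^3^3 \<Rightarrow> bool" where
  "is_rotation Q R \<longleftrightarrow> transpose R ** metric_mat Q ** R = metric_mat Q \<and> det R = 1"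

definition is_rotation_axis :: "real^3 \<Rightarrow> real^3^3 \<Rightarrow> bool" where
  "is_rotation_axis v R \<longleftrightarrow> R *v v = v"

definition S_mat :: "gqns \<Rightarrow> real^3 \<Rightarrow> real^3^3" where
  "S_mat Q v = (let x = v $ 1; y = v $ 2; z = v $ 3 in vector
    [vector [- al1 Q * y - be1 Q * z, al1 Q * x - la1 Q * z, be1 Q * x + la1 Q * y],
     vector [- be2 Q * z - al2 Q * y, al2 Q * x + be1 Q * z, be2 Q * x - be1 Q * y],
     vector [al2 Q * z - al3 Q * y, al3 Q * x - al1 Q * z, al1 Q * y - al2 Q * x]])"

end

theory Submission
  imports Defs
begin

text \<open>
  Everything rests on \<open>S\<^sup>2 = V(v) I - v (M v)\<^sup>T\<close> together with \<open>S v = 0\<close>: they give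
  \<open>S\<^sup>3 = V(v) S\<close>, with \<open>V(v)\<close> equal to \<open>-1\<close>, \<open>1\<close> or \<open>0\<close> in the three cases, so the exponential series
  collapses to \<open>I + s S + r S\<^sup>2\<close>. As \<open>S\<close> is skew for \<open>M\<close>, the matrix
  \<open>(I - s S + r S\<^sup>2) (I + s S + r S\<^sup>2) = I + (2 r - s\<^sup>2 + V(v) r\<^sup>2) S\<^sup>2\<close> measures the failure of
  \<open>I + s S + r S\<^sup>2\<close> to preserve \<open>M\<close>, and the determinant of \<open>I + s S + r S\<^sup>2\<close> is \<open>1 + V(v) (2 r - s\<^sup>2 + V(v) r\<^sup>2)\<close>;
  the bracket vanishes by the Pythagorean identities for \<open>sin, cos\<close> and \<open>sinh, cosh\<close>.
\<close>

section \<open>Bilinearity of the matrix product\<close>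

lemma matrix_add_rdistrib: "(X + Y) ** Z = X ** Z + Y ** Z"
  for X :: "'a::semiring_1^'n^'m"
  by (simp add: vec_eq_iff matrix_matrix_mult_def distrib_right sum.distrib)

lemma matrix_sub_ldistrib: "X ** (Y - Z) = X ** Y - X ** Z"
  for X :: "'a::ring_1^'n^'m"
  by (simp add: vec_eq_iff matrix_matrix_mult_def right_diff_distrib sum_subtractf)

lemma matrix_sub_rdistrib: "(X - Y) ** Z = X ** Z - Y ** Z"
  for X :: "'a::ring_1^'n^'m"
  by (simp add: vec_eq_iff matrix_matrix_mult_def left_diff_distrib sum_subtractf)

lemma matrix_neg_left: "- X ** Y = - (X ** Y)"
  for X :: "'a::ring_1^'n^'m"
  by (simp add: vec_eq_iff matrix_matrix_mult_def sum_negf)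

lemma matrix_neg_right: "X ** - Y = - (X ** Y)"
  for X :: "'a::ring_1^'n^'m"
  by (simp add: vec_eq_iff matrix_matrix_mult_def sum_negf)

lemma transpose_add: "transpose (X + Y) = transpose X + transpose Y"
  by (simp add: vec_eq_iff transpose_def)

section \<open>Exponential of a matrix whose cube is \<open>c\<close> times itself\<close>

lemma matrix_pow_scaleR: "matrix_pow (t *\<^sub>R X) n = t ^ n *\<^sub>R matrix_pow X n"
  for X :: "real^'n^'n"
  by (induction n) (simp_all add: matrix_scalar_ac flip: scalar_matrix_assoc)

text \<open>Left multiplication by \<open>X\<close> sends coefficients \<open>(a, p, q)\<close> of
  \<open>mat 1\<close>, \<open>X\<close>, \<open>X ** X\<close> to \<open>(0, a + c * q, p)\<close>,
  which is the recursion assumed of \<open>p\<close> and \<open>q\<close>. Leaving the sequences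
  abstract lets each value of \<open>c\<close> supply its own closed form.\<close>

lemma matrix_pow_cubic:
  fixes X :: "real^'n^'n"
  assumes cubic: "X ** (X ** X) = c *\<^sub>R X"
    and p: "p 0 = 0" "\<And>n. p (Suc n) = of_bool (n = 0) + c * q n"
    and q: "q 0 = 0" "\<And>n. q (Suc n) = p n"
  shows "matrix_pow X n = of_bool (n = 0) *\<^sub>R mat 1 + p n *\<^sub>R X + q n *\<^sub>R (X ** X)"
proof (induction n)
  case 0
  show ?case by (simp add: p q)
next
  case (Suc n)
  have "matrix_pow X (Suc n)
      = of_bool (n = 0) *\<^sub>R X + p n *\<^sub>R (X ** X) + q n *\<^sub>R (c *\<^sub>R X)"
    by (simp add: Suc.IH matrix_add_ldistrib matrix_scalar_ac cubic
        flip: scalar_matrix_assoc)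
  then show ?case by (simp add: p q algebra_simps)
qed

text \<open>Summing coefficientwise leaves two scalar series, the exponential generating functions
  of \<open>p\<close> and \<open>q\<close> at \<open>t\<close>.\<close>

lemma matrix_exp_cubic:
  fixes X :: "real^'n^'n"
  assumes cubic: "X ** (X ** X) = c *\<^sub>R X"
    and p: "p 0 = 0" "\<And>n. p (Suc n) = of_bool (n = 0) + c * q n"
    and q: "q 0 = 0" "\<And>n. q (Suc n) = p n"
    and s: "(\<lambda>n. p n * t ^ n / fact n) sums s"
    and r: "(\<lambda>n. q n * t ^ n / fact n) sums r"
  shows "matrix_exp (t *\<^sub>R X) = mat 1 + s *\<^sub>R X + r *\<^sub>R (X ** X)"
proof -
  have one: "(\<lambda>n. of_bool (n = 0)) sums (1::real)"
    using sums_single[of 0 "\<lambda>_. 1::real"] by (simp add: of_bool_def)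
  have "(\<lambda>n. of_bool (n = 0) *\<^sub>R mat 1 + (p n * t ^ n / fact n) *\<^sub>R X
      + (q n * t ^ n / fact n) *\<^sub>R (X ** X)) sums (1 *\<^sub>R mat 1 + s *\<^sub>R X + r *\<^sub>R (X ** X))"
    by (intro sums_add sums_scaleR_left one s r)
  moreover have "(1 / fact n) *\<^sub>R matrix_pow (t *\<^sub>R X) n
      = of_bool (n = 0) *\<^sub>R mat 1 + (p n * t ^ n / fact n) *\<^sub>R X
        + (q n * t ^ n / fact n) *\<^sub>R (X ** X)" for n
    unfolding matrix_pow_scaleR matrix_pow_cubic[OF cubic p q]
    by (cases n) (simp_all add: algebra_simps)
  ultimately show ?thesis
    by (simp add: matrix_exp_def sums_iff)
qed

lemma matrix_exp_cubic_neg: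
  fixes X :: "real^'n^'n"
  assumes "X ** (X ** X) = - X"
  shows "matrix_exp (t *\<^sub>R X) = mat 1 + sin t *\<^sub>R X + (1 - cos t) *\<^sub>R (X ** X)"
\<comment> \<open>For \<open>c = -1\<close> the recursion gives 0, 1, 0, -1, ... for
  \<open>p\<close> and 0, 0, 1, 0, -1, ... for \<open>q\<close>: \<open>fact n\<close> times the
  Taylor coefficients of sin and of 1 - cos, with \<open>of_bool (n = 0)\<close> supplying the
  constant 1.\<close>
proof (rule matrix_exp_cubic[where c = "-1"
      and p = "\<lambda>n. fact n * sin_coeff n" and q = "\<lambda>n. of_bool (n = 0) - fact n * cos_coeff n"])
  show "(\<lambda>n. fact n * sin_coeff n * t ^ n / fact n) sums sin t"
    using sin_converges[of t] by simp
  have "(\<lambda>n. of_bool (n = 0) - cos_coeff n * t ^ n) sums (1 - cos t)"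
    using sums_diff[OF sums_single[of 0 "\<lambda>_. 1::real"] cos_converges[of t]]
    by (simp add: of_bool_def)
  moreover have "(of_bool (n = 0) - fact n * cos_coeff n) * t ^ n / fact n
      = of_bool (n = 0) - cos_coeff n * t ^ n" for n
    by (simp add: left_diff_distrib diff_divide_distrib)
  ultimately show "(\<lambda>n. (of_bool (n = 0) - fact n * cos_coeff n) * t ^ n / fact n) sums (1 - cos t)"
    by simp
qed (use assms in \<open>auto simp: sin_coeff_Suc cos_coeff_Suc simp del: of_nat_Suc\<close>)

lemma matrix_exp_cubic_pos:
  fixes X :: "real^'n^'n"
  assumes "X ** (X ** X) = X"
  shows "matrix_exp (t *\<^sub>R X) = mat 1 + sinh t *\<^sub>R X + (cosh t - 1) *\<^sub>R (X ** X)"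
\<comment> \<open>The powers alternate between \<open>X\<close> and \<open>X ** X\<close>;
  \<open>q\<close> omits \<open>n = 0\<close>, hence cosh - 1.\<close>
proof (rule matrix_exp_cubic[where c = 1
      and p = "\<lambda>n. of_bool (odd n)" and q = "\<lambda>n. of_bool (even n) - of_bool (n = 0)"])
  show "(\<lambda>n. of_bool (odd n) * t ^ n / fact n) sums sinh t"
    using sinh_converges[of t]
    by (rule back_subst[of "\<lambda>f. f sums sinh t"]) (auto simp: field_simps)
  show "(\<lambda>n. (of_bool (even n) - of_bool (n = 0)) * t ^ n / fact n) sums (cosh t - 1)"
    using sums_diff[OF cosh_converges[of t] sums_single[of 0 "\<lambda>_. 1::real"]]
    by (rule back_subst[of "\<lambda>f. f sums (cosh t - 1)"]) (auto simp: field_simps)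
qed (use assms in auto)

lemma matrix_exp_cubic_zero:
  fixes X :: "real^'n^'n"
  assumes "X ** (X ** X) = 0"
  shows "matrix_exp (t *\<^sub>R X) = mat 1 + t *\<^sub>R X + (t\<^sup>2 / 2) *\<^sub>R (X ** X)"
\<comment> \<open>Here \<open>X\<close> is nilpotent and the series stops after
  \<open>n = 2\<close>.\<close>
proof (rule matrix_exp_cubic[where c = 0
      and p = "\<lambda>n. of_bool (n = 1)" and q = "\<lambda>n. of_bool (n = 2)"])
  show "(\<lambda>n. of_bool (n = 1) * t ^ n / fact n) sums t"
    using sums_single[of 1 "\<lambda>_. t"]
    by (rule back_subst[of "\<lambda>f. f sums t"]) auto
  show "(\<lambda>n. of_bool (n = 2) * t ^ n / fact n) sums (t\<^sup>2 / 2)"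
    using sums_single[of 2 "\<lambda>_. t\<^sup>2 / 2"]
    by (rule back_subst[of "\<lambda>f. f sums (t\<^sup>2 / 2)"]) (auto simp: numeral_2_eq_2)
qed (use assms in auto)

section \<open>Determinant of a quadratic polynomial in a matrix\<close>

text \<open>
  The eigenvalues of \<open>X\<close> are \<open>0\<close> and the two square roots of \<open>c\<close>. The computation keeps
  \<open>d = det X\<close> general so that it is a polynomial identity in the entries of \<open>X\<close>.
\<close>

lemma det_quadratic_traceless_singular:
  fixes X :: "real^3^3"
  assumes tr: "X $ 1 $ 1 + X $ 2 $ 2 + X $ 3 $ 3 = 0"
    and c: "2 * c = (X ** X) $ 1 $ 1 + (X ** X) $ 2 $ 2 + (X ** X) $ 3 $ 3"
    and det: "det X = 0"
  shows "det (mat 1 + s *\<^sub>R X + r *\<^sub>R (X ** X)) = (1 + c * r)\<^sup>2 - c * s\<^sup>2"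
proof -
  define d where "d = det X"
  have t: "X $ 3 $ 3 = - X $ 1 $ 1 - X $ 2 $ 2"
    using tr by simp
  have c': "c = (X $ 1 $ 1)\<^sup>2 + (X $ 2 $ 2)\<^sup>2 + X $ 1 $ 1 * X $ 2 $ 2
      + X $ 1 $ 2 * X $ 2 $ 1 + X $ 1 $ 3 * X $ 3 $ 1 + X $ 2 $ 3 * X $ 3 $ 2"
    using c by (simp add: matrix_matrix_mult_def sum_3 t power2_eq_square algebra_simps)
  \<comment> \<open>The determinant is the product of 1 + s \<lambda> + r \<lambda>^2 over the
    eigenvalues \<lambda> of \<open>X\<close>. It is expanded in their elementary symmetric
    functions, which are 0, \<open>- c\<close> and \<open>d\<close>.\<close>
  have "det (mat 1 + s *\<^sub>R X + r *\<^sub>R (X ** X))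
      = (1 + c * r)\<^sup>2 - c * s\<^sup>2 + d * (s ^ 3 - 3 * s * r - s * r\<^sup>2 * c + r ^ 3 * d)"
    unfolding d_def c'
    by (simp add: det_3 matrix_matrix_mult_def sum_3 mat_def t) algebra
  then show ?thesis by (simp add: d_def det)
qed

section \<open>Algebra of the matrix of a quadratic vector\<close>

lemmas gqns_coeff_defs = coeff_A_def coeff_B_def coeff_C_def coeff_D_def coeff_E_def coeff_F_def

text \<open>\<open>S_mat Q v\<close> factors as P K, where K is the map taking u to the cross
  product v \<times> u and P is the symmetric matrix with rows \<open>(la1, -be1, al1)\<close>,
  \<open>(-be1, -be2, al2)\<close>, \<open>(al1, al2, al3)\<close>. So \<open>v\<close> is in the
  kernel.\<close>

lemma S_mat_axis: "S_mat Q v *v v = 0"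
  by (simp add: vec_eq_iff forall_3 S_mat_def Let_def matrix_vector_mult_def sum_3 algebra_simps)

text \<open>In the factorization P K, \<open>M_mat Q\<close> is minus the adjugate of P, and P K P
  is the cross product matrix of adj(P) v. Hence the square is a product of two cross product
  matrices, and the triple product expansion gives this form.\<close>

lemma S_mat_square:
  "S_mat Q v ** S_mat Q v
    = V_form Q v *\<^sub>R mat 1 - (\<chi> i j. v $ i * (M_mat Q *v v) $ j)"
  by (simp add: vec_eq_iff forall_3 S_mat_def M_mat_def V_form_def Let_def gqns_coeff_defs
      matrix_matrix_mult_def matrix_vector_mult_def mat_def sum_3 power2_eq_square algebra_simps)

lemma S_mat_cubic: "S_mat Q v ** (S_mat Q v ** S_mat Q v) = V_form Q v *\<^sub>R S_mat Q v"
proof -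
  let ?S = "S_mat Q v" and ?w = "M_mat Q *v v"
  have "?S ** (\<chi> i j. v $ i * ?w $ j) = (\<chi> i j. (?S *v v) $ i * ?w $ j)"
    by (simp add: vec_eq_iff matrix_matrix_mult_def matrix_vector_mult_def sum_distrib_right mult.assoc)
  also have "\<dots> = 0"
    by (simp add: S_mat_axis vec_eq_iff)
  finally show ?thesis
    by (simp add: S_mat_square matrix_sub_ldistrib matrix_scalar_ac flip: scalar_matrix_assoc)
qed

text \<open>Since \<open>M_mat Q\<close> is - adj(P), the product
  \<open>M_mat Q ** S_mat Q v\<close> is - det(P) K, an antisymmetric matrix, while
  \<open>M_mat Q\<close> is symmetric.\<close>

lemma S_mat_skew: "transpose (S_mat Q v) ** M_mat Q = - (M_mat Q ** S_mat Q v)"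
  by (simp add: vec_eq_iff forall_3 S_mat_def M_mat_def Let_def gqns_coeff_defs
      matrix_matrix_mult_def transpose_def sum_3 power2_eq_square algebra_simps)

lemma V_form_eq: "V_form Q v = v \<bullet> (M_mat Q *v v)"
  by (simp add: V_form_def M_mat_def inner_vec_def matrix_vector_mult_def sum_3
      power2_eq_square algebra_simps)

lemma det_S_mat: "det (S_mat Q v) = 0"
  by (simp add: S_mat_def Let_def det_3) algebra


section \<open>Rotations and their axis\<close>

lemma S_mat_is_rotation:
  assumes sr: "s\<^sup>2 = 2 * r + V_form Q v * r\<^sup>2"
  defines "R \<equiv> mat 1 + s *\<^sub>R S_mat Q v + r *\<^sub>R (S_mat Q v ** S_mat Q v)"
  shows "is_rotation Q R"
proof -
  define c where "c = V_form Q v"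
  define S where "S = S_mat Q v"
  define M where "M = M_mat Q"
  have R: "R = mat 1 + s *\<^sub>R S + r *\<^sub>R (S ** S)"
    by (simp add: R_def S_def)
  have cubic: "S ** (S ** S) = c *\<^sub>R S"
    by (simp add: S_def c_def S_mat_cubic)
  have skew: "transpose S ** M = - (M ** S)"
    by (simp add: S_def M_def S_mat_skew)
  have skew2: "transpose (S ** S) ** M = M ** (S ** S)"
  proof -
    have "transpose (S ** S) ** M = transpose S ** (transpose S ** M)"
      by (simp add: matrix_transpose_mul matrix_mul_assoc)
    also have "\<dots> = - (transpose S ** M ** S)"
      by (simp add: skew matrix_neg_right matrix_mul_assoc)
    also have "\<dots> = M ** (S ** S)"
      by (simp add: skew matrix_neg_left matrix_mul_assoc)
    finally show ?thesis .
  qed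
  \<comment> \<open>Moving \<open>M\<close> to the left past the transposes turns \<open>S\<close>
    into \<open>- S\<close> and keeps \<open>S ** S\<close>.\<close>
  have "transpose R ** M = M + s *\<^sub>R (transpose S ** M) + r *\<^sub>R (transpose (S ** S) ** M)"
    by (simp add: R transpose_add transpose_scalar transpose_mat matrix_add_rdistrib
        flip: scalar_matrix_assoc)
  also have "\<dots> = M ** (mat 1 - s *\<^sub>R S + r *\<^sub>R (S ** S))"
    by (simp add: skew skew2 matrix_add_ldistrib matrix_sub_ldistrib matrix_scalar_ac
        flip: scalar_matrix_assoc)
  finally have "transpose R ** M ** R = M ** ((mat 1 - s *\<^sub>R S + r *\<^sub>R (S ** S)) ** R)"
    by (simp add: matrix_mul_assoc)
  also have "(mat 1 - s *\<^sub>R S + r *\<^sub>R (S ** S)) ** R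
      = mat 1 + (2 * r - s\<^sup>2 + c * r\<^sup>2) *\<^sub>R (S ** S)"
  proof -
    \<comment> \<open>With the third and fourth powers reduced, the odd terms in \<open>S\<close>
      cancel in the product.\<close>
    have "(S ** S) ** S = c *\<^sub>R S" "(S ** S) ** (S ** S) = c *\<^sub>R (S ** S)"
      using cubic by (simp_all add: matrix_scalar_ac flip: matrix_mul_assoc scalar_matrix_assoc)
    then show ?thesis
      by (simp add: R matrix_add_ldistrib matrix_sub_ldistrib matrix_add_rdistrib
          matrix_sub_rdistrib matrix_scalar_ac cubic flip: scalar_matrix_assoc)
        (simp add: vec_eq_iff algebra_simps power2_eq_square)
  qed
  also have "\<dots> = mat 1"
    using sr by (simp add: c_def)
  finally have "transpose R ** M ** R = M"
    by simp
  moreover have "det R = (1 + c * r)\<^sup>2 - c * s\<^sup>2"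
    unfolding R
  proof (rule det_quadratic_traceless_singular)
    show "S $ 1 $ 1 + S $ 2 $ 2 + S $ 3 $ 3 = 0"
      by (simp add: S_def S_mat_def Let_def)
    \<comment> \<open>The trace of \<open>S ** S\<close> is three times \<open>c\<close> minus the
      inner product of \<open>v\<close> and \<open>M_mat Q *v v\<close>, which is \<open>c\<close>
      again.\<close>
    show "2 * c = (S ** S) $ 1 $ 1 + (S ** S) $ 2 $ 2 + (S ** S) $ 3 $ 3"
      by (simp add: S_def c_def S_mat_square V_form_eq mat_def inner_vec_def sum_3)
    show "det S = 0"
      by (simp add: S_def det_S_mat)
  qed
  moreover have "\<dots> = 1"
    using sr by (simp add: c_def power2_eq_square algebra_simps)
  ultimately show ?thesis
    by (simp add: is_rotation_def metric_mat_def M_def matrix_scalar_ac flip: scalar_matrix_assoc)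
qed

lemma S_mat_is_rotation_axis:
  "is_rotation_axis v (mat 1 + s *\<^sub>R S_mat Q v + r *\<^sub>R (S_mat Q v ** S_mat Q v))"
  by (simp add: is_rotation_axis_def matrix_vector_mult_add_rdistrib scaleR_matrix_vector_assoc[symmetric]
      matrix_vector_mul_assoc[symmetric] S_mat_axis)

section \<open>Value of the quadratic form on unit vectors\<close>

lemma abs_V_form_unit:
  assumes "gq_unit Q v"
  shows "\<bar>V_form Q v\<bar> = 1"
proof -
  have "gq_inner Q v v = Delta Q * V_form Q v"
    by (simp add: gq_inner_def metric_mat_def V_form_eq scaleR_matrix_vector_assoc[symmetric])
  \<comment> \<open>The sign \<open>Delta Q\<close> disappears under the absolute value.\<close>
  with assms show ?thesis
    by (simp add: gq_unit_def gq_norm_def Delta_def split: if_splits)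
qed

lemma V_form_unit_ellipsoid_or_timelike:
  assumes "gq_unit Q v" "ellipsoid_vector Q v \<or> timelike Q v"
  shows "V_form Q v = -1"
proof -
  \<comment> \<open>The weak inequality also covers \<open>v = 0\<close>, which
    \<open>ellipsoid_vector\<close> admits; absolute value 1 then fixes the value.\<close>
  have "V_form Q v \<le> 0"
    using assms(2)
  proof
    assume "ellipsoid_vector Q v"
    then have "v \<noteq> 0 \<Longrightarrow> v \<bullet> (- M_mat Q *v v) > 0"
      by (simp add: ellipsoid_vector_def ellipsoid_type_def positive_definite_def)
    moreover have "- M_mat Q *v v = - (M_mat Q *v v)"
      by (simp add: vec_eq_iff matrix_vector_mult_def sum_negf)
    ultimately show ?thesis
      by (cases "v = 0") (auto simp: V_form_eq)
  qed (simp add: timelike_def)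
  with abs_V_form_unit[OF assms(1)] show ?thesis
    by simp
qed

lemma V_form_unit_spacelike:
  assumes "gq_unit Q v" "spacelike Q v"
  shows "V_form Q v = 1"
  using abs_V_form_unit[OF assms(1)] assms(2) by (simp add: spacelike_def)

section \<open>Exponential formulas and explicit matrices in the three cases\<close>

theorem theorem18:
  fixes \<alpha>\<^sub>1 \<alpha>\<^sub>2 \<alpha>\<^sub>3 \<beta>\<^sub>1 \<beta>\<^sub>2 l\<^sub>1 :: real
    and Q :: gqns
    and x y z :: real
    and v :: "real^3"
    and A B C D E F :: real
    and s11 s12 s13 s21 s22 s23 s31 s32 s33 :: real
    and S :: "real^3^3"
  assumes Q: "Q = \<lparr>al1 = \<alpha>\<^sub>1, al2 = \<alpha>\<^sub>2, al3 = \<alpha>\<^sub>3, be1 = \<beta>\<^sub>1, be2 = \<beta>\<^sub>2, la1 = l\<^sub>1\<rparr>"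
    and coeffs: "A = coeff_A Q" "B = coeff_B Q" "C = coeff_C Q"
      "D = coeff_D Q" "E = coeff_E Q" "F = coeff_F Q"
    and nondegenerate: "invertible (M_mat Q)"
    and v: "v = vector [x, y, z]"
    and S: "S = S_mat Q v"
    and sigma:
      "s11 = B * y\<^sup>2 + C * z\<^sup>2 + D * x * y + E * x * z + 2 * F * y * z"
      "s12 = D * x\<^sup>2 + B * x * y + F * x * z"
      "s13 = E * x\<^sup>2 + F * x * y + C * x * z"
      "s21 = D * y\<^sup>2 + E * y * z + A * x * y"
      "s22 = A * x\<^sup>2 + C * z\<^sup>2 + D * x * y + 2 * E * x * z + F * y * z"
      "s23 = F * y\<^sup>2 + C * y * z + E * x * y"
      "s31 = E * z\<^sup>2 + D * y * z + A * x * z"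
      "s32 = F * z\<^sup>2 + D * x * z + B * y * z"
      "s33 = A * x\<^sup>2 + B * y\<^sup>2 + 2 * D * x * y + E * x * z + F * y * z"
  shows
    "(gq_unit Q v \<and> (ellipsoid_vector Q v \<or> timelike Q v) \<longrightarrow>
       (\<forall>\<theta>\<in>{0..<2 * pi}. let R = matrix_exp (\<theta> *\<^sub>R S) in
          R = mat 1 + sin \<theta> *\<^sub>R S + (1 - cos \<theta>) *\<^sub>R (S ** S)
          \<and> is_rotation Q R \<and> is_rotation_axis v R
          \<and> R = vector
             [vector [(1 - cos \<theta>) * s11 - (y * \<alpha>\<^sub>1 + z * \<beta>\<^sub>1) * sin \<theta> + 1,
                      (cos \<theta> - 1) * s12 + (x * \<alpha>\<^sub>1 - z * l\<^sub>1) * sin \<theta>,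
                      (cos \<theta> - 1) * s13 + (x * \<beta>\<^sub>1 + y * l\<^sub>1) * sin \<theta>],
              vector [(cos \<theta> - 1) * s21 - (y * \<alpha>\<^sub>2 + z * \<beta>\<^sub>2) * sin \<theta>,
                      (1 - cos \<theta>) * s22 + (x * \<alpha>\<^sub>2 + z * \<beta>\<^sub>1) * sin \<theta> + 1,
                      (cos \<theta> - 1) * s23 + (x * \<beta>\<^sub>2 - y * \<beta>\<^sub>1) * sin \<theta>],
              vector [(cos \<theta> - 1) * s31 + (z * \<alpha>\<^sub>2 - y * \<alpha>\<^sub>3) * sin \<theta>,
                      (cos \<theta> - 1) * s32 + (x * \<alpha>\<^sub>3 - z * \<alpha>\<^sub>1) * sin \<theta>,
                      (1 - cos \<theta>) * s33 + (y * \<alpha>\<^sub>1 - x * \<alpha>\<^sub>2) * sin \<theta> + 1]]))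
     \<and>
     (gq_unit Q v \<and> spacelike Q v \<longrightarrow>
       (\<forall>\<theta>::real. let R = matrix_exp (\<theta> *\<^sub>R S) in
          R = mat 1 + sinh \<theta> *\<^sub>R S - (1 - cosh \<theta>) *\<^sub>R (S ** S)
          \<and> is_rotation Q R \<and> is_rotation_axis v R
          \<and> R = vector
             [vector [(cosh \<theta> - 1) * s11 - (y * \<alpha>\<^sub>1 + z * \<beta>\<^sub>1) * sinh \<theta> + 1,
                      (1 - cosh \<theta>) * s12 + (x * \<alpha>\<^sub>1 - z * l\<^sub>1) * sinh \<theta>,
                      (1 - cosh \<theta>) * s13 + (x * \<beta>\<^sub>1 + y * l\<^sub>1) * sinh \<theta>],
              vector [(1 - cosh \<theta>) * s21 - (y * \<alpha>\<^sub>2 + z * \<beta>\<^sub>2) * sinh \<theta>,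
                      (cosh \<theta> - 1) * s22 + (x * \<alpha>\<^sub>2 + z * \<beta>\<^sub>1) * sinh \<theta> + 1,
                      (1 - cosh \<theta>) * s23 + (x * \<beta>\<^sub>2 - y * \<beta>\<^sub>1) * sinh \<theta>],
              vector [(1 - cosh \<theta>) * s31 + (z * \<alpha>\<^sub>2 - y * \<alpha>\<^sub>3) * sinh \<theta>,
                      (1 - cosh \<theta>) * s32 + (x * \<alpha>\<^sub>3 - z * \<alpha>\<^sub>1) * sinh \<theta>,
                      (cosh \<theta> - 1) * s33 + (y * \<alpha>\<^sub>1 - x * \<alpha>\<^sub>2) * sinh \<theta> + 1]]))
     \<and>
     (lightlike Q v \<longrightarrow>
       (\<forall>\<theta>::real. let R = matrix_exp (- \<theta> *\<^sub>R S) in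
          R = mat 1 - \<theta> *\<^sub>R S + (\<theta>\<^sup>2 / fact 2) *\<^sub>R (S ** S)
          \<and> is_rotation Q R \<and> is_rotation_axis v R
          \<and> R = vector
             [vector [1/2 * \<theta>\<^sup>2 * s11 + (y * \<alpha>\<^sub>1 + z * \<beta>\<^sub>1) * \<theta> + 1,
                      - (1/2) * \<theta>\<^sup>2 * s12 + (z * l\<^sub>1 - x * \<alpha>\<^sub>1) * \<theta>,
                      - (1/2) * \<theta>\<^sup>2 * s13 - (y * l\<^sub>1 + x * \<beta>\<^sub>1) * \<theta>],
              vector [- (1/2) * \<theta>\<^sup>2 * s21 + (y * \<alpha>\<^sub>2 + z * \<beta>\<^sub>2) * \<theta>,
                      1/2 * \<theta>\<^sup>2 * s22 - (x * \<alpha>\<^sub>2 + z * \<beta>\<^sub>1) * \<theta> + 1,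
                      - (1/2) * \<theta>\<^sup>2 * s23 + (y * \<beta>\<^sub>1 - x * \<beta>\<^sub>2) * \<theta>],
              vector [- (1/2) * \<theta>\<^sup>2 * s31 + (y * \<alpha>\<^sub>3 - z * \<alpha>\<^sub>2) * \<theta>,
                      - (1/2) * \<theta>\<^sup>2 * s32 + (z * \<alpha>\<^sub>1 - x * \<alpha>\<^sub>3) * \<theta>,
                      1/2 * \<theta>\<^sup>2 * s33 + (x * \<alpha>\<^sub>2 - y * \<alpha>\<^sub>1) * \<theta> + 1]]))"
proof -
  \<comment> \<open>Off the diagonal the entries are minus those of v (M v)^T; on it, subtracting
    from \<open>V_form Q v\<close> leaves \<open>s11\<close>, \<open>s22\<close>,
    \<open>s33\<close>.\<close>
  have square: "S ** S = vector
      [vector [s11, - s12, - s13], vector [- s21, s22, - s23], vector [- s31, - s32, s33]]"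
    unfolding S S_mat_square
    by (simp add: vec_eq_iff forall_3 v sigma coeffs M_mat_def V_form_def
        matrix_vector_mult_def mat_def sum_3 power2_eq_square algebra_simps)
  have entries: "mat 1 + s *\<^sub>R S + r *\<^sub>R (S ** S) = vector
      [vector [r * s11 - (y * \<alpha>\<^sub>1 + z * \<beta>\<^sub>1) * s + 1,
               - r * s12 + (x * \<alpha>\<^sub>1 - z * l\<^sub>1) * s,
               - r * s13 + (x * \<beta>\<^sub>1 + y * l\<^sub>1) * s],
       vector [- r * s21 - (y * \<alpha>\<^sub>2 + z * \<beta>\<^sub>2) * s,
               r * s22 + (x * \<alpha>\<^sub>2 + z * \<beta>\<^sub>1) * s + 1,
               - r * s23 + (x * \<beta>\<^sub>2 - y * \<beta>\<^sub>1) * s],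
       vector [- r * s31 + (z * \<alpha>\<^sub>2 - y * \<alpha>\<^sub>3) * s,
               - r * s32 + (x * \<alpha>\<^sub>3 - z * \<alpha>\<^sub>1) * s,
               r * s33 + (y * \<alpha>\<^sub>1 - x * \<alpha>\<^sub>2) * s + 1]]" for s r
    unfolding square
    by (simp add: S v Q vec_eq_iff forall_3 mat_def S_mat_def Let_def algebra_simps)
  \<comment> \<open>The premise of \<open>rotation\<close> becomes sin^2 = 2 (1 - cos) - (1 -
    cos)^2, then sinh^2 = 2 (cosh - 1) + (cosh - 1)^2, and finally \<theta>^2 = 2 (\<theta>^2 /
    2).\<close>
  note rotation = S_mat_is_rotation[of _ _ Q v, folded S]
    and axis = S_mat_is_rotation_axis[of v _ Q, folded S]
  have exp_neg: "matrix_exp (\<theta> *\<^sub>R S) = mat 1 + sin \<theta> *\<^sub>R S + (1 - cos \<theta>) *\<^sub>R (S ** S)"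
    and rot_neg: "is_rotation Q (mat 1 + sin \<theta> *\<^sub>R S + (1 - cos \<theta>) *\<^sub>R (S ** S))"
    if "gq_unit Q v" "ellipsoid_vector Q v \<or> timelike Q v" for \<theta>
  proof -
    have V: "V_form Q v = -1"
      using that by (rule V_form_unit_ellipsoid_or_timelike)
    show "matrix_exp (\<theta> *\<^sub>R S) = mat 1 + sin \<theta> *\<^sub>R S + (1 - cos \<theta>) *\<^sub>R (S ** S)"
      by (rule matrix_exp_cubic_neg) (simp add: S S_mat_cubic V)
    show "is_rotation Q (mat 1 + sin \<theta> *\<^sub>R S + (1 - cos \<theta>) *\<^sub>R (S ** S))"
      by (rule rotation) (simp add: V sin_squared_eq power2_eq_square algebra_simps)
  qed
  have exp_pos: "matrix_exp (\<theta> *\<^sub>R S) = mat 1 + sinh \<theta> *\<^sub>R S + (cosh \<theta> - 1) *\<^sub>R (S ** S)"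
    and rot_pos: "is_rotation Q (mat 1 + sinh \<theta> *\<^sub>R S + (cosh \<theta> - 1) *\<^sub>R (S ** S))"
    if "gq_unit Q v" "spacelike Q v" for \<theta>
  proof -
    have V: "V_form Q v = 1"
      using that by (rule V_form_unit_spacelike)
    show "matrix_exp (\<theta> *\<^sub>R S) = mat 1 + sinh \<theta> *\<^sub>R S + (cosh \<theta> - 1) *\<^sub>R (S ** S)"
      by (rule matrix_exp_cubic_pos) (simp add: S S_mat_cubic V)
    show "is_rotation Q (mat 1 + sinh \<theta> *\<^sub>R S + (cosh \<theta> - 1) *\<^sub>R (S ** S))"
      by (rule rotation) (simp add: V sinh_square_eq power2_diff)
  qed
  have exp_zero: "matrix_exp (- \<theta> *\<^sub>R S) = mat 1 + - \<theta> *\<^sub>R S + (\<theta>\<^sup>2 / 2) *\<^sub>R (S ** S)"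
    and rot_zero: "is_rotation Q (mat 1 + - \<theta> *\<^sub>R S + (\<theta>\<^sup>2 / 2) *\<^sub>R (S ** S))"
    if "lightlike Q v" for \<theta>
  proof -
    have V: "V_form Q v = 0"
      using that by (simp add: lightlike_def)
    show "matrix_exp (- \<theta> *\<^sub>R S) = mat 1 + - \<theta> *\<^sub>R S + (\<theta>\<^sup>2 / 2) *\<^sub>R (S ** S)"
      using matrix_exp_cubic_zero[of S "- \<theta>"] by (simp add: S S_mat_cubic V)
    show "is_rotation Q (mat 1 + - \<theta> *\<^sub>R S + (\<theta>\<^sup>2 / 2) *\<^sub>R (S ** S))"
      by (rule rotation) (simp add: V)
  qed
  \<comment> \<open>Cases (b) and (c) are stated with subtractions; both are brought to the shape
    \<open>mat 1 + s *\<^sub>R S + r *\<^sub>R (S ** S)\<close> of \<open>entries\<close>.\<close>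
  have sinh_form: "mat 1 + s *\<^sub>R S - (1 - r) *\<^sub>R (S ** S)
      = mat 1 + s *\<^sub>R S + (r - 1) *\<^sub>R (S ** S)" for s r
    by (simp add: algebra_simps)
  have zero_form: "mat 1 - s *\<^sub>R S + r *\<^sub>R (S ** S)
      = mat 1 + - s *\<^sub>R S + r *\<^sub>R (S ** S)" for s r
    by simp
  show ?thesis
    unfolding Let_def sinh_form zero_form fact_2
    by (intro conjI impI ballI allI; (elim conjE)?;
        simp only: exp_neg exp_pos exp_zero rot_neg rot_pos rot_zero axis;
        simp only: entries; simp add: vec_eq_iff forall_3 algebra_simps)
qed

end
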